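(* Let $K$ be a field, let $f(x)\in K[x]$ be a polynomial of degree $d\ge2$, and let $\alpha\in K$. Assume that for every $n\ge 1$ the polynomial $f^n(x)-\alpha$ has $d^n$ distinct roots in an algebraic closure of $K$ and is irreducible over $K$ (where $f^n$ is the $n$-th iterate of $f$). Let $T$ be the $d$-ary rooted tree of iterated preimages of $\alpha$ under $f$, let $\mathcal P_d$ be its space of infinite paths, and let $H_\infty\subseteq\mathrm{Aut}(T)$ be the image of the arboreal representation $\rho_{f,\alpha}$. Let $G$ be a countably generated dense subgroup of $H_\infty$, regarded as a discrete group and acting on $\mathcal P_d$ by restricting the action of $H_\infty$. If $H_\infty$ has finite index in $\mathrm{Aut}(T)$, then the action of $G$ on $\mathcal P_d$ is wild.
   Context: Tree of preimages. Put $V_0=\{\alpha\}$ and $V_n=f^{-n}(\alpha)$ for $n\ge 1$, the set of solutions of $f^n(x)=\alpha$ in a separable closure $K^{\rm sep}$ of $K$. The tree $T$ has vertex set $\bigsqcup_{n\ge0}V_n$, and $b\in V_{n+1}$ is joined by an edge to $c\in V_n$ if and only if $f(b)=c$; under the assumptions it is a $d$-ary rooted tree. $\mathrm{Aut}(T)$ is the group of automorphisms of the rooted tree. Path space. $\mathcal P_d\subset\prod_{n\ge0}V_n$ is the set of sequences $(v_n)_{n\ge0}$ with $v_n\in V_n$ and $v_n,v_{n+1}$ joined by an edge for all $n$, with the topology induced by the product of the discrete topologies; it is a Cantor set on which $\mathrm{Aut}(T)$ acts by homeomorphisms. Arboreal representation. $\mathrm{Gal}(K^{\rm sep}/K)$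 acts on each $V_n$ by permutations compatibly with the edges of $T$. Let $H_n$ be its image in the automorphism group of the finite subtree $T_n$ with vertices $V_0\cup\dots\cup V_n$. This gives $\rho_{f,\alpha}:\mathrm{Gal}(K^{\rm sep}/K)\to H_\infty=\varprojlim\{H_{n+1}\to H_n\}\subseteq\mathrm{Aut}(T)$, where $\mathrm{Aut}(T)=\varprojlim\mathrm{Aut}(T_n)$ is a profinite group; $H_\infty$ is the image of $\rho_{f,\alpha}$ and acts transitively on each $V_n$. Hence $G$ also acts transitively on each $V_n$, and its action on $\mathcal P_d$ is minimal and equicontinuous. Stable and wild actions. Fix a path $\mathbf v=(v_n)_{n\ge0}\in\mathcal P_d$ and let $G_n=\{g\in G\mid g\cdot v_n=v_n\}$; this is a descending chain of finite index subgroups of $G=G_0$, called the group chain associated to the action and $\mathbf v$. For $n\ge m\ge0$ let $C^m_n=\bigcap_{g\in G_m}gG_ng^{-1}$ (the maximal subgroup of $G_n$ that is normal in $G_m$). The discriminant group of the restricted action of $G_m$ on the set of paths through $v_m$ is the profinite group $$\mathcal D^m_{\mathbf v}=\varprojlim\{G_{n+1}/C^m_{n+1}\to G_n/C^m_n\mid n\ge m\}.$$ For $k\ge m$ the inclusions $C^m_n\subset C^k_n$ ($n\ge k$) induce surjective homomorphisms $G_n/C^m_n\to G_n/C^k_n$ and, in the limit, surjective homomorphisms $\psi_{m,k}:\mathcal D^m_{\mathbf v}\to\mathcal D^k_{\mathbf v}$. The action is stable if there exists $m_0\ge0$ such that $\psi_{m,m+1}$ is an isomorphism for all $m\ge m_0$,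 and wild otherwise. This property does not depend on the choice of $\mathbf v$. *)

theory Defs
  imports
    "HOL-Analysis.Analysis"
    "HOL-Algebra.Algebraic_Closure_Type"
    "HOL-Algebra.Bij"
    "HOL-Algebra.Generated_Groups"
    "HOL-Algebra.Product_Groups"
begin

section \<open>Iterates, separable closure, Galois group\<close>

definition iterate_poly :: "'a::field poly \<Rightarrow> nat \<Rightarrow> 'a poly" where
  "iterate_poly f n = (pcompose f ^^ n) [:0, 1:]"

text \<open>
  The separable closure is the set of elements of the algebraic closure that are separable
  over the ground field, i.e. whose minimal polynomial has only simple roots.
  Separability is tested in the algebraic closure, because \<^const>\<open>rsquarefree\<close> only looks at
  roots in the coefficient field.
\<close>

definition sep_closure :: "'a::field alg_closure set" where
  "sep_closure = {x. \<exists>p :: 'a poly. Factorial_Ring.irreducible p \<and>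
     poly (map_poly to_ac p) x = 0 \<and> rsquarefree (map_poly to_ac p)}"

text \<open>
  As everywhere in \<^theory>\<open>HOL-Algebra.Bij\<close>, permutations of a set are represented by extensional
  functions.
\<close>

definition sep_Galois_group :: "('a::field alg_closure \<Rightarrow> 'a alg_closure) set" where
  "sep_Galois_group = {\<sigma> \<in> Bij sep_closure.
     (\<forall>x\<in>sep_closure. \<forall>y\<in>sep_closure. \<sigma> (x + y) = \<sigma> x + \<sigma> y \<and> \<sigma> (x * y) = \<sigma> x * \<sigma> y) \<and>
     (\<forall>a. \<sigma> (to_ac a) = to_ac a)}"


section \<open>The tree of iterated preimages\<close>

definition preimages :: "'a::field poly \<Rightarrow> 'a \<Rightarrow> nat \<Rightarrow> 'a alg_closure set" where
  "preimages f \<alpha> n = {x \<in> sep_closure. poly (map_poly to_ac (iterate_poly f n)) x = to_ac \<alpha>}"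

text \<open>
  Vertices are tagged with their level, which makes the union of the levels disjoint.
\<close>

type_synonym 'a vertex = "nat \<times> 'a alg_closure"

definition tree_root :: "'a::field \<Rightarrow> 'a vertex" where
  "tree_root \<alpha> = (0, to_ac \<alpha>)"

definition tree_verts :: "'a::field poly \<Rightarrow> 'a \<Rightarrow> 'a vertex set" where
  "tree_verts f \<alpha> = (SIGMA n:UNIV. preimages f \<alpha> n)"

definition subtree_verts :: "'a::field poly \<Rightarrow> 'a \<Rightarrow> nat \<Rightarrow> 'a vertex set" where
  "subtree_verts f \<alpha> n = (SIGMA k:{..n}. preimages f \<alpha> k)"

definition tree_edges :: "'a::field poly \<Rightarrow> 'a \<Rightarrow> 'a vertex set set" where
  "tree_edges f \<alpha> = {{(Suc n, b), (n, c)} | n b c.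
     b \<in> preimages f \<alpha> (Suc n) \<and> c \<in> preimages f \<alpha> n \<and> poly (map_poly to_ac f) b = c}"

text \<open>
  Automorphisms of the graph induced on \<open>V\<close> by the edge set \<open>E\<close> that fix the root \<open>r\<close>.
\<close>

definition rooted_auts :: "'v set \<Rightarrow> 'v set set \<Rightarrow> 'v \<Rightarrow> ('v \<Rightarrow> 'v) set" where
  "rooted_auts V E r =
     {g \<in> Bij V. g r = r \<and> (\<forall>u\<in>V. \<forall>w\<in>V. {g u, g w} \<in> E \<longleftrightarrow> {u, w} \<in> E)}"

definition tree_Aut :: "'a::field poly \<Rightarrow> 'a \<Rightarrow> ('a vertex \<Rightarrow> 'a vertex) monoid" where
  "tree_Aut f \<alpha> = (BijGroup (tree_verts f \<alpha>))
     \<lparr>carrier := rooted_auts (tree_verts f \<alpha>) (tree_edges f \<alpha>) (tree_root \<alpha>)\<rparr>"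

text \<open>
  The profinite topology: an automorphism is identified with the sequence of its restrictions
  to the finite subtrees, an element of the inverse limit of the discrete groups of
  automorphisms of these subtrees.
\<close>

definition tree_Aut_topology :: "'a::field poly \<Rightarrow> 'a \<Rightarrow> ('a vertex \<Rightarrow> 'a vertex) topology" where
  "tree_Aut_topology f \<alpha> =
     pullback_topology (carrier (tree_Aut f \<alpha>))
       (\<lambda>g n. restrict g (subtree_verts f \<alpha> n))
       (product_topology
          (\<lambda>n. discrete_topology
             (rooted_auts (subtree_verts f \<alpha> n) (tree_edges f \<alpha>) (tree_root \<alpha>))) UNIV)"

text \<open>
  A path is a sequence of (tagged) vertices; the \<open>n\<close>-th vertex lies on level \<open>n\<close>.
\<close>

definition path_space :: "'a::field poly \<Rightarrow> 'a \<Rightarrow> (nat \<Rightarrow> 'a vertex) set" where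
  "path_space f \<alpha> = {v. \<forall>n. v n \<in> {n} \<times> preimages f \<alpha> n \<and> {v n, v (Suc n)} \<in> tree_edges f \<alpha>}"

definition arboreal_rep ::
    "'a::field poly \<Rightarrow> 'a \<Rightarrow> ('a alg_closure \<Rightarrow> 'a alg_closure) \<Rightarrow> 'a vertex \<Rightarrow> 'a vertex" where
  "arboreal_rep f \<alpha> \<sigma> = (\<lambda>(n, x) \<in> tree_verts f \<alpha>. (n, \<sigma> x))"

definition arboreal_image :: "'a::field poly \<Rightarrow> 'a \<Rightarrow> ('a vertex \<Rightarrow> 'a vertex) set" where
  "arboreal_image f \<alpha> = arboreal_rep f \<alpha> ` sep_Galois_group"


section \<open>Group chains, discriminant groups, stable and wild actions\<close>

text \<open>
  Here \<open>\<Gamma>\<close> is a group and \<open>Gs\<close> a descending chain of subgroups of \<open>\<Gamma>\<close>.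
\<close>

definition chain_core ::
    "('g, 'b) monoid_scheme \<Rightarrow> (nat \<Rightarrow> 'g set) \<Rightarrow> nat \<Rightarrow> nat \<Rightarrow> 'g set" where
  "chain_core \<Gamma> Gs m n = (\<Inter>g\<in>Gs m. g <#\<^bsub>\<Gamma>\<^esub> Gs n #>\<^bsub>\<Gamma>\<^esub> inv\<^bsub>\<Gamma>\<^esub> g)"

definition chain_quot ::
    "('g, 'b) monoid_scheme \<Rightarrow> (nat \<Rightarrow> 'g set) \<Rightarrow> nat \<Rightarrow> nat \<Rightarrow> 'g set monoid" where
  "chain_quot \<Gamma> Gs m n = (\<Gamma>\<lparr>carrier := Gs n\<rparr>) Mod chain_core \<Gamma> Gs m n"

text \<open>
  The homomorphism of quotient groups induced by inclusions \<open>A \<subseteq> B\<close> and \<open>M \<subseteq> N\<close>, from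
  \<open>A / M\<close> to \<open>B / N\<close>, sends the coset \<open>a M\<close> to \<open>a N = N (a M)\<close>; on cosets it is therefore
  multiplication by \<open>N\<close>. This gives both the bonding maps of the inverse system and the
  maps between the discriminant groups.
\<close>

definition discriminant_group ::
    "('g, 'b) monoid_scheme \<Rightarrow> (nat \<Rightarrow> 'g set) \<Rightarrow> nat \<Rightarrow> (nat \<Rightarrow> 'g set) monoid" where
  "discriminant_group \<Gamma> Gs m = (product_group {m..} (chain_quot \<Gamma> Gs m))
     \<lparr>carrier := {x \<in> carrier (product_group {m..} (chain_quot \<Gamma> Gs m)).
        \<forall>n\<ge>m. chain_core \<Gamma> Gs m n <#>\<^bsub>\<Gamma>\<^esub> x (Suc n) = x n}\<rparr>"

definition discriminant_map ::
    "('g, 'b) monoid_scheme \<Rightarrow> (nat \<Rightarrow> 'g set) \<Rightarrow> nat \<Rightarrow> (nat \<Rightarrow> 'g set) \<Rightarrow> nat \<Rightarrow> 'g set" where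
  "discriminant_map \<Gamma> Gs k x = (\<lambda>n\<in>{k..}. chain_core \<Gamma> Gs k n <#>\<^bsub>\<Gamma>\<^esub> x n)"

definition stable_chain :: "('g, 'b) monoid_scheme \<Rightarrow> (nat \<Rightarrow> 'g set) \<Rightarrow> bool" where
  "stable_chain \<Gamma> Gs \<longleftrightarrow> (\<exists>m0. \<forall>m\<ge>m0.
     discriminant_map \<Gamma> Gs (Suc m) \<in> iso (discriminant_group \<Gamma> Gs m) (discriminant_group \<Gamma> Gs (Suc m)))"

definition group_chain :: "('v \<Rightarrow> 'v) set \<Rightarrow> (nat \<Rightarrow> 'v) \<Rightarrow> nat \<Rightarrow> ('v \<Rightarrow> 'v) set" where
  "group_chain G v n = {g \<in> G. g (v n) = v n}"

text \<open>
  Stability of the action of the group \<open>\<Gamma>\<close> of tree automorphisms on the space of paths,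
  computed from the group chain at the path \<open>v\<close>.
\<close>

definition stable_action :: "('v \<Rightarrow> 'v, 'b) monoid_scheme \<Rightarrow> (nat \<Rightarrow> 'v) \<Rightarrow> bool" where
  "stable_action \<Gamma> v \<longleftrightarrow> stable_chain \<Gamma> (group_chain (carrier \<Gamma>) v)"

definition wild_action :: "('v \<Rightarrow> 'v, 'b) monoid_scheme \<Rightarrow> (nat \<Rightarrow> 'v) \<Rightarrow> bool" where
  "wild_action \<Gamma> v \<longleftrightarrow> \<not> stable_action \<Gamma> v"

end

theory Submission
  imports Defs
begin

text \<open>
  The closure of \<open>G\<close> in \<open>Aut(T)\<close> is closed of finite index, hence open, so it contains
  every automorphism that is trivial up to some level \<open>N\<close>. Let \<open>m \<ge> N\<close>, let \<open>w\<close> be a sibling of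
  \<open>v (m + 1)\<close>, and let \<open>\<tau>\<close> exchange the subtrees at two children of \<open>w\<close> and fix everything else.
  Then \<open>\<tau>\<close> lies in the closure of \<open>G\<close> and fixes the path \<open>v\<close>. It is trivial on the subtree at
  \<open>v (m + 1)\<close>, but not on the part of the tree reached from \<open>v\<close> by the stabilizer of \<open>v m\<close>, because
  some element of \<open>G\<close> acts up to level \<open>m + 1\<close> like the exchange of the subtrees at \<open>v (m + 1)\<close>
  and \<open>w\<close>. So approximations of \<open>\<tau>\<close> in \<open>G\<close> define a nontrivial element of the kernel of
  \<open>\<psi>\<close> from level \<open>m\<close> to level \<open>m + 1\<close>.
\<close>

section \<open>Regular rooted trees\<close>

text \<open>This isolates the combinatorics from field theory: the tree is encoded by a level and a
  parent function. The value of \<open>par\<close> at the root is left arbitrary, hence the guards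
  \<open>x \<noteq> r\<close>.\<close>

locale regular_tree =
  fixes V :: "'v set" and lev :: "'v \<Rightarrow> nat" and par :: "'v \<Rightarrow> 'v" and r :: 'v and d :: nat
  assumes root_in: "r \<in> V"
    and lev_eq_0_iff: "x \<in> V \<Longrightarrow> lev x = 0 \<longleftrightarrow> x = r"
    and par_in: "x \<in> V \<Longrightarrow> x \<noteq> r \<Longrightarrow> par x \<in> V"
    and lev_par: "x \<in> V \<Longrightarrow> x \<noteq> r \<Longrightarrow> lev x = Suc (lev (par x))"
    and card_children': "c \<in> V \<Longrightarrow> card {x \<in> V. x \<noteq> r \<and> par x = c} = d"
    and d_ge_2: "d \<ge> 2"
begin

definition children :: "'v \<Rightarrow> 'v set" where
  "children c = {x \<in> V. x \<noteq> r \<and> par x = c}"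

definition edges :: "'v set set" where
  "edges = {{x, par x} | x. x \<in> V \<and> x \<noteq> r}"

definition Aut :: "('v \<Rightarrow> 'v) monoid" where
  "Aut = (BijGroup V)\<lparr>carrier := rooted_auts V edges r\<rparr>"

text \<open>An arbitrary numbering of the children of each vertex. It identifies the subtrees below
  any two vertices of the same level, which is how an exchange of siblings extends
  downwards.\<close>

definition enum :: "'v \<Rightarrow> 'v \<Rightarrow> nat" where
  "enum c = (SOME \<theta>. bij_betw \<theta> (children c) {..<d})"

lemma bij_betw_enum: "c \<in> V \<Longrightarrow> bij_betw (enum c) (children c) {..<d}"
proof -
  assume "c \<in> V"
  then have "card (children c) = d" by (simp add: children_def card_children')
  moreover have "finite (children c)" 
    using calculation d_ge_2 card_ge_0_finite[of "children c"] by simp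
  ultimately have "\<exists>\<theta>. bij_betw \<theta> (children c) {..<d}"
    by (metis card_lessThan finite_lessThan finite_same_card_bij)
  then show ?thesis unfolding enum_def by (rule someI_ex)
qed

lemma ex_other_child:
  assumes "c \<in> V"
  obtains b where "b \<in> children c" "b \<noteq> a"
proof -
  have "card (children c) \<ge> 2" using assms d_ge_2 by (simp add: children_def card_children')
  then have "\<not> children c \<subseteq> {a}"
    using card_mono[of "{a}" "children c"] by auto
  then show ?thesis using that by auto
qed

lemma childrenD:
  assumes "x \<in> children c"
  shows "x \<in> V" "x \<noteq> r" "par x = c" "lev x = Suc (lev c)" "c \<in> V"
  using assms lev_par par_in by (auto simp: children_def)

text \<open>
  Outside the children of \<open>par a\<close>, the \<open>i\<close>-th child of a vertex goes to the \<open>i\<close>-th child of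
  the image of that vertex. This makes the map an involution.
\<close>

primrec swap_level :: "'v \<Rightarrow> 'v \<Rightarrow> nat \<Rightarrow> 'v \<Rightarrow> 'v" where
  "swap_level a b 0 x = x"
| "swap_level a b (Suc n) x =
     (if par x = par a then Transposition.transpose a b x
      else let q = swap_level a b n (par x)
           in inv_into (children q) (enum q) (enum (par x) x))"

text \<open>The clauses go through one induction because the image of \<open>x\<close> is built from
  the image of its parent. The last clause concerns the ancestor at the level of \<open>a\<close>;
  above that level truncated subtraction makes it \<open>x\<close> itself.\<close>

lemma swap_level:
  assumes a: "a \<in> children c" and b: "b \<in> children c" and "x \<in> V" "lev x = n"
  shows "swap_level a b n x \<in> V \<and> lev (swap_level a b n x) = n
    \<and> swap_level a b n (swap_level a b n x) = x
    \<and> (x \<noteq> r \<longrightarrow> par (swap_level a b n x) = swap_level a b (n - 1) (par x))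
    \<and> ((par ^^ (n - lev a)) x \<notin> {a, b} \<longrightarrow> swap_level a b n x = x)"
  using assms(3,4)
proof (induction n arbitrary: x)
  case 0
  then show ?case by (simp add: lev_eq_0_iff)
next
  case (Suc n)
  have xr: "x \<noteq> r" using Suc.prems lev_eq_0_iff[of x] by simp
  define p where "p = par x"
  define q where "q = swap_level a b n p"
  define y where "y = swap_level a b (Suc n) x"
  have p: "p \<in> V" "lev p = n" "x \<in> children p"
    using Suc.prems xr par_in lev_par by (auto simp: p_def children_def)
  have parc: "par a = c" "par b = c" "lev a = Suc (lev c)" "lev b = Suc (lev c)" "c \<in> V"
    using childrenD[OF a] childrenD[OF b] by auto
  have fix_c: "swap_level a b n c = c" if "lev c = n"
    using Suc.IH[of c] that parc by force
  have q: "q \<in> V" "lev q = n" "swap_level a b n q = p"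
    "(par ^^ (n - lev a)) p \<notin> {a, b} \<longrightarrow> q = p"
    using Suc.IH[OF p(1,2)] by (auto simp: q_def)
  show ?case
  proof (cases "p = c")
    case True
    have y: "y = Transposition.transpose a b x" using True parc by (simp add: y_def p_def)
    have yc: "y \<in> children c"
      using a b p(3) True by (auto simp: y Transposition.transpose_def)
    have "swap_level a b (Suc n) y = x"
      using childrenD(3)[OF yc] parc by (simp add: y)
    moreover have "lev a = Suc n" using parc p True by simp
    ultimately show ?thesis
      using childrenD[OF yc] True p fix_c y
      by (auto simp: y_def[symmetric] p_def[symmetric] simp del: swap_level.simps)
  next
    case False
    have y: "y = inv_into (children q) (enum q) (enum p x)"
      using False parc by (simp add: y_def p_def q_def Let_def)
    \<comment> \<open>Both numberings have range \<open>{..<d}\<close>, so the index of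
      \<open>x\<close> below \<open>p\<close> also occurs below \<open>q\<close>.\<close>
    have "enum p x \<in> {..<d}"
      using bij_betw_enum[OF p(1)] p(3) by (auto simp: bij_betw_def)
    then have yq: "y \<in> children q" and ey: "enum q y = enum p x"
      using bij_betw_enum[OF q(1)] unfolding y bij_betw_def
      by (metis inv_into_into) (metis bij_betw_def bij_betw_enum f_inv_into_f q(1) \<open>enum p x \<in> {..<d}\<close>)
    \<comment> \<open>A second application must take the same branch of the recursion:
      \<open>q = c\<close> would give \<open>p = c\<close>, since \<open>c\<close> is fixed.\<close>
    have qc: "q \<noteq> c" using fix_c q False by auto
    have inv: "inv_into (children p) (enum p) (enum p x) = x"
      using bij_betw_enum[OF p(1)] p(3) by (simp add: bij_betw_def)
    have invol: "swap_level a b (Suc n) y = x"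
      using childrenD(3)[OF yq] qc parc q(3) ey inv by (simp add: Let_def)
    have "y = x" if *: "(par ^^ (Suc n - lev a)) x \<notin> {a, b}"
    proof -
      have "(par ^^ (n - lev a)) p \<notin> {a, b}"
      proof (cases "lev a \<le> n")
        case True
        then show ?thesis using * by (simp add: Suc_diff_le funpow_swap1 p_def del: funpow.simps)
          (simp add: funpow_swap1)
      \<comment> \<open>The iterate is now \<open>p\<close> itself, whose level is too small for
        \<open>a\<close> or \<open>b\<close>.\<close>
      next
        case False
        then show ?thesis using p parc by auto
      qed
      then show ?thesis using q y inv by simp
    qed
    then show ?thesis
      using childrenD[OF yq] q invol
      by (auto simp: y_def[symmetric] p_def[symmetric] q_def[symmetric] simp del: swap_level.simps)
  qed
qed

text \<open>For an involution, preserving edges in one direction is enough: applying the map to the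
  image edge gives the converse.\<close>

lemma Aut_I_involution:
  assumes ext: "g \<in> extensional V" and V: "\<And>x. x \<in> V \<Longrightarrow> g x \<in> V"
    and inv: "\<And>x. x \<in> V \<Longrightarrow> g (g x) = x" and root: "g r = r"
    and par: "\<And>x. x \<in> V \<Longrightarrow> x \<noteq> r \<Longrightarrow> par (g x) = g (par x)"
  shows "g \<in> carrier Aut"
proof -
  have bij: "bij_betw g V V"
    using V inv by (intro bij_betw_byWitness[where f' = g]) auto
  have im: "{g u, g w} \<in> edges" if uw: "{u, w} \<in> edges" for u w
  proof -
    obtain x where x: "x \<in> V" "x \<noteq> r" "{u, w} = {x, par x}"
      using uw unfolding edges_def by blast
    have "g x \<noteq> r" using x inv root by metis
    moreover have "{g u, g w} = g ` {u, w}" by simp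
    then have "{g u, g w} = {g x, par (g x)}" using x par by simp
    ultimately show ?thesis using x V by (auto simp: edges_def)
  qed
  have "{g u, g w} \<in> edges \<longleftrightarrow> {u, w} \<in> edges" if "u \<in> V" "w \<in> V" for u w
    using im[of u w] im[of "g u" "g w"] inv that by auto
  then show ?thesis
    using bij ext root by (simp add: Aut_def rooted_auts_def Bij_def)
qed

text \<open>The condition on the iterate of \<open>par\<close> says that \<open>x\<close> lies in
  neither of the subtrees at \<open>a\<close> and \<open>b\<close>.\<close>

lemma ex_swap:
  assumes a: "a \<in> children c" and b: "b \<in> children c"
  obtains g where "g \<in> carrier Aut" "g a = b"
    "\<And>x. x \<in> V \<Longrightarrow> (par ^^ (lev x - lev a)) x \<notin> {a, b} \<Longrightarrow> g x = x"
proof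
  define g where "g = (\<lambda>x\<in>V. swap_level a b (lev x) x)"
  note s = swap_level[OF a b _ refl]
  show "g \<in> carrier Aut"
  proof (rule Aut_I_involution)
    fix x assume x: "x \<in> V"
    show "g x \<in> V" "g (g x) = x" using s[OF x] x by (simp_all add: g_def)
    assume "x \<noteq> r"
    then show "par (g x) = g (par x)"
      using s[OF x] x par_in[OF x] lev_par[OF x] by (simp add: g_def)
  next
    show "g r = r" using root_in lev_eq_0_iff[OF root_in] by (simp add: g_def)
  qed (simp add: g_def)
  show "g a = b" using childrenD[OF a] by (simp add: g_def)
  show "g x = x" if "x \<in> V" "(par ^^ (lev x - lev a)) x \<notin> {a, b}" for x
    using s[OF that(1)] that by (simp add: g_def)
qed

section \<open>The automorphism group of a regular tree\<close>

lemma mult_Aut_apply: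
  "g \<in> carrier Aut \<Longrightarrow> h \<in> carrier Aut \<Longrightarrow> x \<in> V \<Longrightarrow> (g \<otimes>\<^bsub>Aut\<^esub> h) x = g (h x)"
  by (simp add: Aut_def BijGroup_def rooted_auts_def compose_eq)

lemma one_Aut: "\<one>\<^bsub>Aut\<^esub> = (\<lambda>x\<in>V. x)"
  by (simp add: Aut_def BijGroup_def)

lemma Aut_in: "g \<in> carrier Aut \<Longrightarrow> x \<in> V \<Longrightarrow> g x \<in> V"
  by (auto simp: Aut_def rooted_auts_def Bij_def bij_betw_def)

lemma Aut_inj: "g \<in> carrier Aut \<Longrightarrow> x \<in> V \<Longrightarrow> y \<in> V \<Longrightarrow> g x = g y \<longleftrightarrow> x = y"
  by (auto simp: Aut_def rooted_auts_def Bij_def bij_betw_def inj_on_def)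

lemma group_Aut: "group Aut"
proof -
  interpret B: group "BijGroup V" by (rule group_BijGroup)
  have "subgroup (rooted_auts V edges r) (BijGroup V)"
  proof (rule B.subgroupI)
    show "rooted_auts V edges r \<subseteq> carrier (BijGroup V)"
      by (auto simp: rooted_auts_def BijGroup_def)
    have "(\<lambda>x\<in>V. x) \<in> rooted_auts V edges r"
      using root_in by (auto simp: rooted_auts_def id_Bij)
    then show "rooted_auts V edges r \<noteq> {}" by blast
  next
    fix g assume g: "g \<in> rooted_auts V edges r"
    then have gB: "g \<in> Bij V" by (simp add: rooted_auts_def)
    let ?h = "\<lambda>x\<in>V. inv_into V g x"
    have hg: "?h x \<in> V" "g (?h x) = x" if "x \<in> V" for x
      using gB that by (auto simp: Bij_def bij_betw_def inv_into_into f_inv_into_f)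
    have "?h r = r"
      using gB g root_in by (simp add: Bij_def rooted_auts_def bij_betw_def)
        (metis inv_into_f_f)
    moreover have "{?h u, ?h w} \<in> edges \<longleftrightarrow> {u, w} \<in> edges" if "u \<in> V" "w \<in> V" for u w
    proof -
      have "{g (?h u), g (?h w)} \<in> edges \<longleftrightarrow> {?h u, ?h w} \<in> edges"
        using g hg(1) that unfolding rooted_auts_def by blast
      then show ?thesis using hg(2) that by simp
    qed
    ultimately have "?h \<in> rooted_auts V edges r"
      using restrict_inv_into_Bij[OF gB] by (simp add: rooted_auts_def)
    then show "inv\<^bsub>BijGroup V\<^esub> g \<in> rooted_auts V edges r"
      by (simp add: inv_BijGroup[OF gB])
  next
    fix g h assume gh: "g \<in> rooted_auts V edges r" "h \<in> rooted_auts V edges r"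
    then have B: "g \<in> Bij V" "h \<in> Bij V" by (simp_all add: rooted_auts_def)
    have "h x \<in> V" if "x \<in> V" for x using B(2) that by (auto simp: Bij_def bij_betw_def)
    then have "compose V g h \<in> rooted_auts V edges r"
      using gh root_in compose_Bij[OF B] by (simp add: rooted_auts_def compose_eq)
    then show "g \<otimes>\<^bsub>BijGroup V\<^esub> h \<in> rooted_auts V edges r"
      using B by (simp add: BijGroup_def)
  qed
  then show ?thesis unfolding Aut_def by (rule subgroup.subgroup_is_group) (rule group_BijGroup)
qed

lemma inv_Aut_apply:
  assumes "g \<in> carrier Aut" "x \<in> V"
  shows "(inv\<^bsub>Aut\<^esub> g) (g x) = x" "g ((inv\<^bsub>Aut\<^esub> g) x) = x"
proof -
  interpret group Aut by (rule group_Aut)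
  have g': "inv\<^bsub>Aut\<^esub> g \<in> carrier Aut" using assms(1) by simp
  have "((inv\<^bsub>Aut\<^esub> g) \<otimes>\<^bsub>Aut\<^esub> g) x = x" using assms by (simp add: one_Aut)
  then show "(inv\<^bsub>Aut\<^esub> g) (g x) = x" by (simp only: mult_Aut_apply[OF g' assms])
  have "(g \<otimes>\<^bsub>Aut\<^esub> (inv\<^bsub>Aut\<^esub> g)) x = x" using assms by (simp add: one_Aut)
  then show "g ((inv\<^bsub>Aut\<^esub> g) x) = x" by (simp only: mult_Aut_apply[OF assms(1) g' assms(2)])
qed

text \<open>The edge from \<open>x\<close> to its parent goes to an edge, and levels decide which
  end of it is the parent. Level preservation is a hypothesis because elements of the arboreal image
  have it by construction.\<close>

lemma par_Aut:
  assumes g: "g \<in> carrier Aut" and lev: "\<And>x. x \<in> V \<Longrightarrow> lev (g x) = lev x" and x: "x \<in> V" "x \<noteq> r"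
  shows "par (g x) = g (par x)"
proof -
  have "{x, par x} \<in> edges" using x by (auto simp: edges_def)
  then have "{g x, g (par x)} \<in> edges"
    using g x par_in by (simp add: Aut_def rooted_auts_def)
  then obtain y where y: "y \<in> V" "y \<noteq> r" "{g x, g (par x)} = {y, par y}"
    by (auto simp: edges_def)
  have "lev (g x) = Suc (lev (g (par x)))" using x par_in lev lev_par by simp
  moreover have "lev y = Suc (lev (par y))" using y lev_par by simp
  ultimately show ?thesis using y(3) by (auto simp: doubleton_eq_iff)
qed

end


section \<open>Group chains\<close>

lemma chain_quot_carrier:
  "carrier (chain_quot \<Gamma> Gs m n) = {chain_core \<Gamma> Gs m n #>\<^bsub>\<Gamma>\<^esub> a | a. a \<in> Gs n}"
  by (auto simp: chain_quot_def FactGroup_def RCOSETS_def r_coset_def)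

text \<open>This evaluates the bonding maps and the maps between discriminant groups, both of which
  are multiplication of a coset by a larger core.\<close>

lemma (in group) set_mult_rcos_absorb:
  assumes A: "subgroup A G" and B: "B \<subseteq> A" "B \<noteq> {}" and a: "a \<in> carrier G"
  shows "A <#> (B #> a) = A #> a"
proof -
  interpret A: subgroup A G by (rule A)
  have "A <#> B = A"
  proof
    show "A <#> B \<subseteq> A" using B by (auto simp: set_mult_def)
    show "A \<subseteq> A <#> B"
    proof
      fix x assume x: "x \<in> A"
      obtain b where b: "b \<in> B" using B by blast
      have "x = (x \<otimes> inv b) \<otimes> b"
        using x b B(1) A.mem_carrier by (simp add: m_assoc subset_eq)
      moreover have "x \<otimes> inv b \<in> A" using x b B(1) by auto
      ultimately show "x \<in> A <#> B" using b unfolding set_mult_def by blast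
    qed
  qed
  then show ?thesis
    using setmult_rcos_assoc[of A B a] A.subset B(1) a by auto
qed

text \<open>
  The family \<open>g\<close> represents a nontrivial element of the kernel of the map between the
  discriminant groups of levels \<open>m\<close> and \<open>Suc m\<close>.
\<close>

lemma (in group) not_stable_chainI:
  assumes Gs: "\<And>n. Gs n \<subseteq> carrier G" "\<And>n. \<one> \<in> Gs n"
    and core: "\<And>m n. subgroup (chain_core G Gs m n) G"
    and core_Suc: "\<And>m n. n \<ge> m \<Longrightarrow> chain_core G Gs m (Suc n) \<subseteq> chain_core G Gs m n"
    and core_mono: "\<And>m n. chain_core G Gs m n \<subseteq> chain_core G Gs (Suc m) n"
    and ker: "\<And>m0. \<exists>m\<ge>m0. \<exists>g. (\<forall>n. g n \<in> Gs n)
      \<and> (\<forall>n. g (Suc n) \<in> chain_core G Gs m n #> g n)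
      \<and> (\<forall>n\<ge>Suc m. g n \<in> chain_core G Gs (Suc m) n)
      \<and> (\<exists>n\<ge>m. g n \<notin> chain_core G Gs m n)"
  shows "\<not> stable_chain G Gs"
proof
  assume "stable_chain G Gs"
  then obtain m0 where m0: "\<And>m. m \<ge> m0 \<Longrightarrow> discriminant_map G Gs (Suc m) \<in>
    iso (discriminant_group G Gs m) (discriminant_group G Gs (Suc m))"
    by (auto simp: stable_chain_def)
  obtain m g where m: "m \<ge> m0" and g: "\<And>n. g n \<in> Gs n"
    and g_Suc: "\<And>n. g (Suc n) \<in> chain_core G Gs m n #> g n"
    and g_ker: "\<And>n. n \<ge> Suc m \<Longrightarrow> g n \<in> chain_core G Gs (Suc m) n"
    and g_nontriv: "\<exists>n\<ge>m. g n \<notin> chain_core G Gs m n"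
    using ker[of m0] by blast
  let ?C = "chain_core G Gs"
  have gG: "g n \<in> carrier G" for n using g Gs by blast
  have ne: "?C m n \<noteq> {}" for m n using subgroup.one_closed[OF core] by blast
  \<comment> \<open>The sequence of cosets represented by a family \<open>h\<close>; the constant
    family \<open>\<one>\<close> represents the identity.\<close>
  define x where "x = (\<lambda>h. \<lambda>n\<in>{m..}. ?C m n #> (h n :: 'a))"
  have mem: "x h \<in> carrier (discriminant_group G Gs m)"
    if h: "\<And>n. h n \<in> Gs n" and h_Suc: "\<And>n. h (Suc n) \<in> ?C m n #> h n" for h
  proof -
    have hG: "h n \<in> carrier G" for n using h Gs by blast
    have "?C m n <#> (?C m (Suc n) #> h (Suc n)) = ?C m n #> h n" if "n \<ge> m" for n
    proof -
      have "?C m n <#> (?C m (Suc n) #> h (Suc n)) = ?C m n #> h (Suc n)"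
        by (intro set_mult_rcos_absorb core core_Suc that ne hG)
      also have "\<dots> = ?C m n #> h n"
        by (rule repr_independence[symmetric]) (auto intro: h_Suc hG core)
      finally show ?thesis .
    qed
    then show ?thesis
      using h by (auto simp: discriminant_group_def x_def chain_quot_carrier)
  qed
  have img: "discriminant_map G Gs (Suc m) (x h) = (\<lambda>n\<in>{Suc m..}. ?C (Suc m) n)"
    if "\<And>n. n \<ge> Suc m \<Longrightarrow> h n \<in> ?C (Suc m) n" for h
    unfolding discriminant_map_def
  proof (rule restrict_ext)
    fix n assume "n \<in> {Suc m..}"
    then have n: "n \<ge> Suc m" by simp
    then have hn: "h n \<in> ?C (Suc m) n" by (rule that)
    have "h n \<in> carrier G" using hn subgroup.mem_carrier[OF core] by blast
    then have "?C (Suc m) n <#> (?C m n #> h n) = ?C (Suc m) n #> h n"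
      by (intro set_mult_rcos_absorb core core_mono ne)
    also have "\<dots> = ?C (Suc m) n"
      using hn subgroup.mem_carrier[OF core] by (intro coset_join2 core) blast+
    finally show "?C (Suc m) n <#> x h n = ?C (Suc m) n"
      using n by (simp add: x_def)
  qed
  \<comment> \<open>Injectivity is what fails: \<open>g\<close> and the constant family
    \<open>\<one>\<close> have the same image, the sequence of trivial cosets, but represent
    different elements.\<close>
  have "inj_on (discriminant_map G Gs (Suc m)) (carrier (discriminant_group G Gs m))"
    using m0[OF m] by (auto simp: iso_def bij_betw_def)
  moreover have "x g \<in> carrier (discriminant_group G Gs m)"
    by (rule mem[OF g g_Suc])
  moreover have "x (\<lambda>_. \<one>) \<in> carrier (discriminant_group G Gs m)"
    using Gs(2) core subgroup.subset rcos_self[OF one_closed core] by (intro mem) auto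
  moreover have "discriminant_map G Gs (Suc m) (x g) = discriminant_map G Gs (Suc m) (x (\<lambda>_. \<one>))"
    using img[of g] img[of "\<lambda>_. \<one>"] g_ker subgroup.one_closed[OF core] by simp
  ultimately have eq: "x g = x (\<lambda>_. \<one>)" by (simp add: inj_on_def)
  obtain n where n: "n \<ge> m" "g n \<notin> ?C m n" using g_nontriv by blast
  have "?C m n #> g n = ?C m n #> \<one>"
    using fun_cong[OF eq, of n] n(1) by (simp add: x_def)
  then have "?C m n #> g n = ?C m n" using subgroup.subset[OF core] coset_mult_one by simp
  then have "g n \<in> ?C m n" using rcos_self[OF gG core] by metis
  then show False using n by simp
qed

section \<open>Stabilizer chains of a path in a regular tree\<close>

context regular_tree
begin

text \<open>
  The closure of \<open>G\<close> has finite index, hence it is open. Otherwise infinitely many \<open>s n\<close>, where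
  \<open>s n\<close> fixes all levels up to \<open>n\<close>, lie outside the closure and in one coset of it; then
  \<open>s k \<otimes> inv (s n)\<close> is in the closure and tends to \<open>s k\<close> as \<open>n\<close> grows.
\<close>

lemma closure_contains_level_stabilizer:
  assumes G: "subgroup G Aut" and lev: "\<And>g x. g \<in> G \<Longrightarrow> x \<in> V \<Longrightarrow> lev (g x) = lev x"
    and H: "H \<subseteq> carrier Aut" "G \<subseteq> H" and fin: "finite (rcosets\<^bsub>Aut\<^esub> H)"
    and dense: "\<And>h n. h \<in> H \<Longrightarrow> \<exists>g\<in>G. \<forall>x\<in>V. lev x \<le> n \<longrightarrow> g x = h x"
  shows "\<exists>N. \<forall>g\<in>carrier Aut. (\<forall>x\<in>V. lev x \<le> N \<longrightarrow> g x = x) \<longrightarrow>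
    (\<forall>n. \<exists>h\<in>G. \<forall>x\<in>V. lev x \<le> n \<longrightarrow> h x = g x)"
proof -
  interpret group Aut by (rule group_Aut)
  interpret G: subgroup G Aut by (rule G)
  \<comment> \<open>\<open>K\<close> is the closure of \<open>G\<close> in \<open>Aut\<close>,
    written in terms of levels.\<close>
  define K where "K = {g \<in> carrier Aut. \<forall>n. \<exists>h\<in>G. \<forall>x\<in>V. lev x \<le> n \<longrightarrow> h x = g x}"
  have "\<exists>N. \<forall>g\<in>carrier Aut. (\<forall>x\<in>V. lev x \<le> N \<longrightarrow> g x = x) \<longrightarrow> g \<in> K"
  proof (rule ccontr)
    assume "\<not> ?thesis"
    then have "\<forall>N. \<exists>g. g \<in> carrier Aut \<and> (\<forall>x\<in>V. lev x \<le> N \<longrightarrow> g x = x) \<and> g \<notin> K"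
      by blast
    then obtain s where s: "\<And>N. s N \<in> carrier Aut" "\<And>N x. x \<in> V \<Longrightarrow> lev x \<le> N \<Longrightarrow> s N x = x"
      "\<And>N. s N \<notin> K" by metis
    have "(\<lambda>N. H #>\<^bsub>Aut\<^esub> s N) ` UNIV \<subseteq> rcosets\<^bsub>Aut\<^esub> H"
      using s(1) by (auto simp: RCOSETS_def)
    then have "finite (range (\<lambda>N. H #>\<^bsub>Aut\<^esub> s N))" using fin finite_subset by blast
    then obtain k where k: "infinite {N. H #>\<^bsub>Aut\<^esub> s N = H #>\<^bsub>Aut\<^esub> s k}"
      using pigeonhole_infinite[of UNIV "\<lambda>N. H #>\<^bsub>Aut\<^esub> s N"] by auto
    have "\<exists>h\<in>G. \<forall>x\<in>V. lev x \<le> n \<longrightarrow> h x = s k x" for n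
    proof -
      obtain N where N: "N \<ge> n" "H #>\<^bsub>Aut\<^esub> s N = H #>\<^bsub>Aut\<^esub> s k"
        using k by (metis (mono_tags, lifting) infinite_nat_iff_unbounded_le mem_Collect_eq)
      \<comment> \<open>\<open>H\<close> is just a set containing \<open>G\<close>, so membership of
        \<open>s N\<close> in its own coset comes from \<open>\<one>\<close> in
        \<open>G\<close>.\<close>
      have "s N \<in> H #>\<^bsub>Aut\<^esub> s N"
      proof -
        have "s N = \<one>\<^bsub>Aut\<^esub> \<otimes>\<^bsub>Aut\<^esub> s N" using s(1) by simp
        moreover have "\<one>\<^bsub>Aut\<^esub> \<in> H" using G.one_closed H(2) by blast
        ultimately show ?thesis unfolding r_coset_def by blast
      qed
      then have "\<exists>h\<in>H. s N = h \<otimes>\<^bsub>Aut\<^esub> s k"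
        unfolding N(2) by (simp add: r_coset_def)
      then obtain h where h: "h \<in> H" "s N = h \<otimes>\<^bsub>Aut\<^esub> s k" by blast
      obtain g where g: "g \<in> G" "\<And>x. x \<in> V \<Longrightarrow> lev x \<le> n \<Longrightarrow> g x = h x"
        using dense[OF h(1)] by metis
      have gA: "g \<in> carrier Aut" and hA: "h \<in> carrier Aut" using g(1) h(1) H by auto
      \<comment> \<open>Since \<open>s N\<close> is trivial up to level \<open>n\<close>, the
        inverse of \<open>h\<close> agrees with \<open>s k\<close> there. As \<open>inv g\<close>
        preserves levels, \<open>g\<close> and \<open>h\<close> agree at \<open>?y\<close>, so
        \<open>inv g\<close> approximates \<open>s k\<close> as well.\<close>
      let ?g' = "inv\<^bsub>Aut\<^esub> g"
      have g': "?g' \<in> G" using g(1) by simp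
      have "?g' x = s k x" if x: "x \<in> V" "lev x \<le> n" for x
      proof -
        let ?y = "?g' x"
        have y: "?y \<in> V" "lev ?y = lev x"
          using Aut_in[OF _ x(1)] lev[OF g' x(1)] g' by simp_all
        have "h (s k x) = s N x" using h(2) mult_Aut_apply[OF hA s(1) x(1)] by simp
        also have "\<dots> = x" using s(2) x N(1) by simp
        also have "x = g ?y" using inv_Aut_apply(2)[OF gA x(1)] by simp
        also have "\<dots> = h ?y" using g(2) y x by simp
        finally show ?thesis using Aut_inj[OF hA y(1) Aut_in[OF s(1)[of k] x(1)]] by simp
      qed
      then show ?thesis using g' by blast
    qed
    then show False using s(1,3)[of k] by (simp add: K_def)
  qed
  then show ?thesis unfolding K_def by blast
qed

text \<open>Conjugating the stabilizer of \<open>v n\<close> by \<open>h\<close> gives the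
  stabilizer of \<open>h (v n)\<close>. The core is thus the pointwise stabilizer of an orbit, and
  conjugates disappear from the later arguments.\<close>

lemma chain_core_group_chain:
  assumes G: "subgroup G Aut" and v: "\<And>n. v n \<in> V"
  shows "chain_core (Aut\<lparr>carrier := G\<rparr>) (group_chain G v) m n
    = {k \<in> G. \<forall>h\<in>G. h (v m) = v m \<longrightarrow> k (h (v n)) = h (v n)}"
proof -
  interpret group Aut by (rule group_Aut)
  interpret G: subgroup G Aut by (rule G)
  let ?\<Gamma> = "Aut\<lparr>carrier := G\<rparr>"
  have inv: "inv\<^bsub>?\<Gamma>\<^esub> h = inv\<^bsub>Aut\<^esub> h" if "h \<in> G" for h
    using m_inv_consistent[OF G that] .
  have conj: "k \<in> h <#\<^bsub>?\<Gamma>\<^esub> group_chain G v n #>\<^bsub>?\<Gamma>\<^esub> inv\<^bsub>?\<Gamma>\<^esub> h \<longleftrightarrow> k \<in> G \<and> k (h (v n)) = h (v n)"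
    if h: "h \<in> G" for k h
  proof -
    have hA: "h \<in> carrier Aut" using h by simp
    have "k \<in> h <#\<^bsub>?\<Gamma>\<^esub> group_chain G v n #>\<^bsub>?\<Gamma>\<^esub> inv\<^bsub>?\<Gamma>\<^esub> h \<longleftrightarrow>
      (\<exists>l\<in>G. l (v n) = v n \<and> k = h \<otimes>\<^bsub>Aut\<^esub> l \<otimes>\<^bsub>Aut\<^esub> inv\<^bsub>Aut\<^esub> h)"
      using inv[OF h] by (auto simp: l_coset_def r_coset_def group_chain_def)
    also have "\<dots> \<longleftrightarrow> k \<in> G \<and> k (h (v n)) = h (v n)"
    proof
      assume "\<exists>l\<in>G. l (v n) = v n \<and> k = h \<otimes>\<^bsub>Aut\<^esub> l \<otimes>\<^bsub>Aut\<^esub> inv\<^bsub>Aut\<^esub> h"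
      then obtain l where l: "l \<in> G" "l (v n) = v n" "k = h \<otimes>\<^bsub>Aut\<^esub> l \<otimes>\<^bsub>Aut\<^esub> inv\<^bsub>Aut\<^esub> h" by blast
      have "k (h (v n)) = h (l ((inv\<^bsub>Aut\<^esub> h) (h (v n))))"
        using l(1) h hA by (simp add: l(3) mult_Aut_apply Aut_in v)
      then have "k (h (v n)) = h (v n)" using l(2) inv_Aut_apply(1)[OF hA v] by simp
      moreover have "k \<in> G" unfolding l(3) using l(1) h by (intro G.m_closed G.m_inv_closed)
      ultimately show "k \<in> G \<and> k (h (v n)) = h (v n)" by simp
    next
      assume k: "k \<in> G \<and> k (h (v n)) = h (v n)"
      define l where "l = inv\<^bsub>Aut\<^esub> h \<otimes>\<^bsub>Aut\<^esub> (k \<otimes>\<^bsub>Aut\<^esub> h)"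
      have "l \<in> G" using k h by (auto simp: l_def)
      moreover have "l (v n) = v n"
        using k h v inv_Aut_apply(1)[OF hA v] by (simp add: l_def mult_Aut_apply Aut_in)
      moreover have "h \<otimes>\<^bsub>Aut\<^esub> l \<otimes>\<^bsub>Aut\<^esub> inv\<^bsub>Aut\<^esub> h = k"
      proof -
        have kA: "k \<in> carrier Aut" using k by simp
        have "h \<otimes>\<^bsub>Aut\<^esub> l = k \<otimes>\<^bsub>Aut\<^esub> h"
          unfolding l_def by (subst m_assoc[symmetric]) (simp_all add: hA kA)
        then show ?thesis by (simp add: m_assoc hA kA)
      qed
      ultimately show "\<exists>l\<in>G. l (v n) = v n \<and> k = h \<otimes>\<^bsub>Aut\<^esub> l \<otimes>\<^bsub>Aut\<^esub> inv\<^bsub>Aut\<^esub> h" by metis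
    qed
    finally show ?thesis .
  qed
  \<comment> \<open>The intersection runs over a nonempty set, so it forces \<open>k\<close> into
    \<open>G\<close>.\<close>
  have one: "\<one>\<^bsub>Aut\<^esub> \<in> group_chain G v m" using v by (simp add: group_chain_def one_Aut)
      (use G.one_closed in \<open>simp add: one_Aut\<close>)
  have "k \<in> chain_core ?\<Gamma> (group_chain G v) m n \<longleftrightarrow>
      (\<forall>h\<in>group_chain G v m. k \<in> G \<and> k (h (v n)) = h (v n))" for k
    unfolding chain_core_def INT_iff
    by (intro ball_cong refl conj) (simp add: group_chain_def)
  then have "chain_core ?\<Gamma> (group_chain G v) m n =
      {k \<in> G. \<forall>h\<in>group_chain G v m. k (h (v n)) = h (v n)}"
    using one by blast
  also have "\<dots> = {k \<in> G. \<forall>h\<in>G. h (v m) = v m \<longrightarrow> k (h (v n)) = h (v n)}"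
    by (auto simp: group_chain_def)
  finally show ?thesis .
qed

text \<open>\<open>H\<close> stands for the arboreal image. Density is phrased by levels, so that
  the profinite topology enters only in the application.\<close>

theorem group_chain_not_stable:
  assumes G: "subgroup G Aut" and lev: "\<And>g x. g \<in> G \<Longrightarrow> x \<in> V \<Longrightarrow> lev (g x) = lev x"
    and H: "H \<subseteq> carrier Aut" "G \<subseteq> H" and fin: "finite (rcosets\<^bsub>Aut\<^esub> H)"
    and dense: "\<And>h n. h \<in> H \<Longrightarrow> \<exists>g\<in>G. \<forall>x\<in>V. lev x \<le> n \<longrightarrow> g x = h x"
    and v: "\<And>n. v n \<in> V" "\<And>n. lev (v n) = n" "\<And>n. par (v (Suc n)) = v n"
  shows "\<not> stable_chain (Aut\<lparr>carrier := G\<rparr>) (group_chain G v)"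
proof -
  interpret A: group Aut by (rule group_Aut)
  interpret G: subgroup G Aut by (rule G)
  let ?\<Gamma> = "Aut\<lparr>carrier := G\<rparr>"
  interpret \<Gamma>: group ?\<Gamma> by (rule A.subgroup_imp_group[OF G])
  have "\<exists>N. \<forall>g\<in>carrier Aut. (\<forall>x\<in>V. lev x \<le> N \<longrightarrow> g x = x) \<longrightarrow>
      (\<forall>n. \<exists>h\<in>G. \<forall>x\<in>V. lev x \<le> n \<longrightarrow> h x = g x)"
    by (rule closure_contains_level_stabilizer) (fact assms)+
  then obtain N where N0: "\<forall>g\<in>carrier Aut. (\<forall>x\<in>V. lev x \<le> N \<longrightarrow> g x = x) \<longrightarrow>
      (\<forall>n. \<exists>h\<in>G. \<forall>x\<in>V. lev x \<le> n \<longrightarrow> h x = g x)" ..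
  have N: "\<exists>h\<in>G. \<forall>x\<in>V. lev x \<le> n \<longrightarrow> h x = g x"
    if "g \<in> carrier Aut" "\<And>x. x \<in> V \<Longrightarrow> lev x \<le> N \<Longrightarrow> g x = x" for g n
    by (rule N0[rule_format, OF that(1)]) (rule that(2))
  let ?C = "chain_core ?\<Gamma> (group_chain G v)"
  have C_iff: "k \<in> ?C m n \<longleftrightarrow> k \<in> G \<and> (\<forall>h\<in>G. h (v m) = v m \<longrightarrow> k (h (v n)) = h (v n))" for k m n
    by (simp add: chain_core_group_chain[OF G v(1)])
  have G_in: "g x \<in> V" if "g \<in> G" "x \<in> V" for g x using that Aut_in by simp
  have mult: "(g \<otimes>\<^bsub>Aut\<^esub> h) x = g (h x)" if "g \<in> G" "h \<in> G" "x \<in> V" for g h x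
    using that by (simp add: mult_Aut_apply)
  have inv: "(inv\<^bsub>Aut\<^esub> g) (g x) = x" "g ((inv\<^bsub>Aut\<^esub> g) x) = x" if "g \<in> G" "x \<in> V" for g x
    using inv_Aut_apply that by simp_all
  have vr: "v (Suc n) \<noteq> r" for n using v lev_eq_0_iff by (metis nat.distinct(1))
  have par_v: "par (h (v (Suc n))) = h (v n)" if "h \<in> G" for h n
    using par_Aut[of h "v (Suc n)"] that lev v vr by simp
  have anc: "(par ^^ k) (h (v (k + n))) = h (v n)" if "h \<in> G" for h k n
    by (induction k) (simp_all add: par_v[OF that] funpow_swap1)
  have fix_parent: "h (v n) = v n" if "h \<in> G" "h (v (Suc n)) = v (Suc n)" for h n
    using par_v[OF that(1), of n] that v(3) by simp
  show ?thesis
  proof (rule \<Gamma>.not_stable_chainI)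
    show "group_chain G v n \<subseteq> carrier ?\<Gamma>" for n by (auto simp: group_chain_def)
    show "\<one>\<^bsub>?\<Gamma>\<^esub> \<in> group_chain G v n" for n
      using G.one_closed v by (simp add: group_chain_def one_Aut)
    show "subgroup (?C m n) ?\<Gamma>" for m n
    proof (rule \<Gamma>.subgroupI)
      show "?C m n \<subseteq> carrier ?\<Gamma>" using C_iff by auto
      have "\<one>\<^bsub>Aut\<^esub> \<in> ?C m n"
        using C_iff G.one_closed G_in v(1) by (simp add: one_Aut)
      then show "?C m n \<noteq> {}" by blast
    next
      fix g assume g: "g \<in> ?C m n"
      then have gG: "g \<in> G" using C_iff by blast
      have "(inv\<^bsub>Aut\<^esub> g) (h (v n)) = h (v n)" if "h \<in> G" "h (v m) = v m" for h
        using inv(1)[OF gG G_in[OF that(1) v(1)]] g that C_iff by metis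
      then show "inv\<^bsub>?\<Gamma>\<^esub> g \<in> ?C m n"
        using gG C_iff by (simp add: A.m_inv_consistent[OF G gG])
    next
      fix g h assume "g \<in> ?C m n" "h \<in> ?C m n"
      then show "g \<otimes>\<^bsub>?\<Gamma>\<^esub> h \<in> ?C m n"
        using mult G_in v(1) by (simp add: C_iff)
    qed
    show "?C m (Suc n) \<subseteq> ?C m n" for m n
    proof
      fix g assume "g \<in> ?C m (Suc n)"
      then have g: "g \<in> G" and gf: "\<And>h. h \<in> G \<Longrightarrow> h (v m) = v m \<Longrightarrow> g (h (v (Suc n))) = h (v (Suc n))"
        using C_iff by auto
      have "g (h (v n)) = h (v n)" if h: "h \<in> G" "h (v m) = v m" for h
      proof -
        have "g (h (v n)) = par ((g \<otimes>\<^bsub>Aut\<^esub> h) (v (Suc n)))"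
          using par_v[OF G.m_closed[OF g h(1)]] mult[OF g h(1)] v(1) by simp
        also have "\<dots> = par (h (v (Suc n)))"
          using mult[OF g h(1)] v(1) gf[OF h] by simp
        also have "\<dots> = h (v n)" by (rule par_v[OF h(1)])
        finally show ?thesis .
      qed
      then show "g \<in> ?C m n" using g C_iff by blast
    qed
    show "?C m n \<subseteq> ?C (Suc m) n" for m n
    proof
      fix g assume "g \<in> ?C m n"
      \<comment> \<open>An element fixing \<open>v (Suc m)\<close> fixes its parent
        \<open>v m\<close>, so passing to \<open>Suc m\<close> leaves fewer conditions.\<close>
      then show "g \<in> ?C (Suc m) n" using fix_parent[of _ m] by (simp add: C_iff)
    qed
  next
    fix m0
    \<comment> \<open>\<open>m \<ge> N\<close> makes automorphisms that are trivial up to level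
      \<open>m\<close> approximable in \<open>G\<close>.\<close>
    define m where "m = max m0 N"
    define c where "c = v m"
    define a where "a = v (Suc m)"
    have cV: "c \<in> V" using v by (simp add: c_def)
    have a: "a \<in> children c"
      using v vr by (simp add: children_def c_def a_def)
    obtain w where w: "w \<in> children c" "w \<noteq> a" using ex_other_child[OF cV] by blast
    have lev_a: "lev a = Suc m" and lev_w: "lev w = Suc m"
      using childrenD(4)[OF a] childrenD(4)[OF w(1)] v by (simp_all add: c_def)
    obtain \<sigma> where \<sigma>: "\<sigma> \<in> carrier Aut" "\<sigma> a = w"
        "\<And>x. x \<in> V \<Longrightarrow> (par ^^ (lev x - lev a)) x \<notin> {a, w} \<Longrightarrow> \<sigma> x = x"
      using ex_swap[OF a w(1)] by metis
    have \<sigma>_fix: "\<sigma> x = x" if "x \<in> V" "lev x \<le> m" for x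
    proof -
      have "x \<noteq> a" "x \<noteq> w" using that(2) lev_a lev_w by auto
      then show ?thesis using \<sigma>(3)[OF that(1)] that(2) lev_a by simp
    qed
    \<comment> \<open>Agreement with \<open>\<sigma>\<close> up to level \<open>Suc m\<close>
      suffices for \<open>h\<close> to fix \<open>v m\<close> and send \<open>a\<close> to
      \<open>w\<close>.\<close>
    have "\<exists>h\<in>G. \<forall>x\<in>V. lev x \<le> Suc m \<longrightarrow> h x = \<sigma> x"
      by (rule N[OF \<sigma>(1)]) (simp add: \<sigma>_fix m_def)
    then obtain h where h: "h \<in> G" "\<And>x. x \<in> V \<Longrightarrow> lev x \<le> Suc m \<Longrightarrow> h x = \<sigma> x"
      by blast
    have h_m: "h (v m) = v m" using h(2)[of "v m"] \<sigma>_fix v by simp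
    have h_a: "h a = w" using h(2)[of a] \<sigma>(2) v by (simp add: a_def)
    \<comment> \<open>This child of \<open>w\<close> lies in the orbit of
      \<open>v (Suc (Suc m))\<close> under the stabilizer of \<open>v m\<close>, so moving it is
      visible in the core of level \<open>m\<close>.\<close>
    define u where "u = h (v (Suc (Suc m)))"
    have lev_u: "lev u = Suc (Suc m)" "u \<in> V" using h(1) lev v G_in by (simp_all add: u_def)
    moreover have "par u = w" using par_v[OF h(1)] h_a by (simp add: u_def a_def)
    ultimately have u: "u \<in> children w" using lev_eq_0_iff[of u] by (auto simp: children_def)
    obtain u' where u': "u' \<in> children w" "u' \<noteq> u"
      using ex_other_child[OF childrenD(1)[OF w(1)]] by blast
    obtain \<tau> where \<tau>: "\<tau> \<in> carrier Aut" "\<tau> u = u'"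
        "\<And>x. x \<in> V \<Longrightarrow> (par ^^ (lev x - lev u)) x \<notin> {u, u'} \<Longrightarrow> \<tau> x = x"
      using ex_swap[OF u u'(1)] by metis
    have lev_u': "lev u' = Suc (Suc m)" using childrenD(4)[OF u'(1)] lev_w by simp
    have \<tau>_fix: "\<tau> x = x" if "x \<in> V" "lev x \<le> Suc m" for x
    proof -
      have "x \<noteq> u" "x \<noteq> u'" using that(2) lev_u lev_u' by auto
      then show ?thesis using \<tau>(3)[OF that(1)] that(2) lev_u by simp
    qed
    \<comment> \<open>\<open>\<tau>\<close> itself need not lie in \<open>G\<close>; it is replaced
      by a sequence \<open>g\<close> converging to it.\<close>
    have "\<exists>g\<in>G. \<forall>x\<in>V. lev x \<le> n \<longrightarrow> g x = \<tau> x" for n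
      by (rule N[OF \<tau>(1)]) (simp add: \<tau>_fix m_def)
    then obtain g where g: "\<And>n. g n \<in> G" "\<And>n x. x \<in> V \<Longrightarrow> lev x \<le> n \<Longrightarrow> g n x = \<tau> x"
      by metis
    have \<tau>_below: "\<tau> (k (v n)) = k (v n)" if k: "k \<in> G" "k a = a" and n: "n \<ge> Suc m" for k n
    proof (rule \<tau>(3))
      show "k (v n) \<in> V" using k(1) v G_in by blast
      have lk: "lev (k (v n)) = n" using k(1) v lev by simp
      show "(par ^^ (lev (k (v n)) - lev u)) (k (v n)) \<notin> {u, u'}"
      \<comment> \<open>At level \<open>Suc m\<close> the subtraction truncates and the vertex is
        \<open>a\<close>. Further down, the ancestor at the level of \<open>u\<close> is a child of
        \<open>a\<close>, whereas \<open>u\<close> and \<open>u'\<close> are children of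
        \<open>w\<close>.\<close>
      proof (cases "n = Suc m")
        case True
        then have "(par ^^ (lev (k (v n)) - lev u)) (k (v n)) = a"
          using lev_u lk k(2) by (simp add: a_def)
        then show ?thesis using lev_u lev_u' lev_a by auto
      next
        case False
        then have n': "n \<ge> Suc (Suc m)" using n by simp
        have "(par ^^ (lev (k (v n)) - lev u)) (k (v n)) = k (v (Suc (Suc m)))"
          using anc[OF k(1), of "n - Suc (Suc m)" "Suc (Suc m)"]
          by (simp only: le_add_diff_inverse2[OF n'] lk lev_u(1))
        moreover have "par (k (v (Suc (Suc m)))) = a"
          using par_v[OF k(1), of "Suc m"] k(2) by (simp add: a_def)
        ultimately show ?thesis using w(2) childrenD(3)[OF u] childrenD(3)[OF u'(1)] by auto
      qed
    qed
    have \<tau>_v: "\<tau> (v n) = v n" for n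
      using \<tau>_below[OF G.one_closed, of n] \<tau>_fix[of "v n"] v by (cases "n \<ge> Suc m") (simp_all add: one_Aut a_def)
    show "\<exists>m\<ge>m0. \<exists>g. (\<forall>n. g n \<in> group_chain G v n)
      \<and> (\<forall>n. g (Suc n) \<in> ?C m n #>\<^bsub>?\<Gamma>\<^esub> g n)
      \<and> (\<forall>n\<ge>Suc m. g n \<in> ?C (Suc m) n)
      \<and> (\<exists>n\<ge>m. g n \<notin> ?C m n)"
    proof (intro exI conjI allI impI)
      show "m \<ge> m0" by (simp add: m_def)
      show "g n \<in> group_chain G v n" for n
        using g \<tau>_v v by (simp add: group_chain_def)
      show "g (Suc n) \<in> ?C m n #>\<^bsub>?\<Gamma>\<^esub> g n" for n
      proof -
        \<comment> \<open>Both factors come from elements agreeing with \<open>\<tau>\<close> up to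
          level \<open>n\<close>, so \<open>k\<close> fixes level \<open>n\<close>.\<close>
        define k where "k = g (Suc n) \<otimes>\<^bsub>Aut\<^esub> inv\<^bsub>Aut\<^esub> (g n)"
        have gi: "inv\<^bsub>Aut\<^esub> (g n) \<in> G" using g by simp
        have "k (h (v n)) = h (v n)" if "h \<in> G" for h
        proof -
          define z where "z = (inv\<^bsub>Aut\<^esub> (g n)) (h (v n))"
          have hv: "h (v n) \<in> V" using that v G_in by blast
          then have z: "z \<in> V" "lev z = n" using gi G_in lev that v by (simp_all add: z_def)
          have "k (h (v n)) = g (Suc n) z" using mult[OF g(1) gi hv] by (simp add: k_def z_def)
          also have "\<dots> = g n z" using g(2) z by simp
          also have "\<dots> = h (v n)" using inv(2)[OF g(1) hv] by (simp add: z_def)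
          finally show ?thesis .
        qed
        moreover have "k \<in> G" using g gi by (auto simp: k_def)
        ultimately have "k \<in> ?C m n" using C_iff by blast
        moreover have "g (Suc n) = k \<otimes>\<^bsub>Aut\<^esub> g n"
          using g(1) by (simp add: k_def A.m_assoc)
        ultimately show ?thesis by (auto simp: r_coset_def)
      qed
      show "g n \<in> ?C (Suc m) n" if "n \<ge> Suc m" for n
        using g \<tau>_below that lev v G_in by (simp add: C_iff a_def)
      \<comment> \<open>The witness is the level of \<open>u\<close>, the first level at which
        \<open>\<tau>\<close> moves a vertex.\<close>
      show "Suc (Suc m) \<ge> m" by simp
      have "g (Suc (Suc m)) u = u'" using g(2)[of u] lev_u \<tau>(2) by simp
      then show "g (Suc (Suc m)) \<notin> ?C m (Suc (Suc m))"
        using u'(2) h(1) h_m C_iff by (auto simp: u_def)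
    qed
  qed
qed

end


section \<open>Trees of iterated preimages\<close>

lemma iterate_poly_0: "iterate_poly f 0 = [:0, 1:]"
  by (simp add: iterate_poly_def)

lemma iterate_poly_Suc: "iterate_poly f (Suc n) = pcompose f (iterate_poly f n)"
  by (simp add: iterate_poly_def)

text \<open>The parent map applies \<open>f\<close> first, so \<open>f\<close> must be the innermost
  factor, while the definition puts it outermost.\<close>

lemma iterate_poly_Suc_right: "iterate_poly f (Suc n) = pcompose (iterate_poly f n) f"
  by (induction n) (simp_all add: iterate_poly_0 iterate_poly_Suc pcompose_pCons pcompose_assoc)

lemma degree_iterate_poly: "Polynomial.degree (iterate_poly f n) = Polynomial.degree f ^ n"
  by (induction n) (simp_all add: iterate_poly_0 iterate_poly_Suc degree_pcompose)

lemma map_poly_to_ac_pCons: "map_poly to_ac (pCons a p) = pCons (to_ac a) (map_poly to_ac p)"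
  by (simp add: map_poly_pCons)

lemma map_poly_to_ac_add: "map_poly to_ac (p + q) = map_poly to_ac p + map_poly to_ac q"
  by (intro poly_eqI) (simp add: coeff_map_poly)

lemma map_poly_to_ac_diff: "map_poly to_ac (p - q) = map_poly to_ac p - map_poly to_ac q"
  by (intro poly_eqI) (simp add: coeff_map_poly)

lemma map_poly_to_ac_mult: "map_poly to_ac (p * q) = map_poly to_ac p * map_poly to_ac q"
  by (intro poly_eqI) (simp add: coeff_map_poly coeff_mult to_ac_sum)

lemma map_poly_to_ac_pcompose:
  "map_poly to_ac (pcompose p q) = pcompose (map_poly to_ac p) (map_poly to_ac q)"
  by (induction p)
    (simp_all add: pcompose_pCons map_poly_to_ac_pCons map_poly_to_ac_add map_poly_to_ac_mult)

lemma degree_map_poly_to_ac: "Polynomial.degree (map_poly to_ac p) = Polynomial.degree p"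
  by (simp add: degree_map_poly)

text \<open>The multiplicities sum to at most the degree, which is the number of roots, and each is
  at least 1; hence all equal 1.\<close>

lemma rsquarefreeI_card_roots:
  fixes p :: "'a::idom poly"
  assumes "p \<noteq> 0" and "card {x. poly p x = 0} = Polynomial.degree p"
  shows "rsquarefree p"
proof -
  have fin: "finite {x. poly p x = 0}" using assms(1) by (rule poly_roots_finite)
  have "(\<Sum>x\<in>{x. poly p x = 0}. Polynomial.order x p) = size (proots p)"
    using assms(1) by (simp add: size_multiset_overloaded_eq)
  also have "\<dots> \<le> (\<Sum>x\<in>{x. poly p x = 0}. 1)"
    using size_proots_le[of p] assms(2) by simp
  finally have le: "(\<Sum>x\<in>{x. poly p x = 0}. Polynomial.order x p) \<le> (\<Sum>x\<in>{x. poly p x = 0}. 1)" .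
  have ge: "1 \<le> Polynomial.order x p" if "x \<in> {x. poly p x = 0}" for x
    using that assms(1) by (simp add: order_root Suc_le_eq)
  have "Polynomial.order x p = 1" if x: "poly p x = 0" for x
  proof (rule ccontr)
    assume "Polynomial.order x p \<noteq> 1"
    then have "1 < Polynomial.order x p" using ge[of x] x by simp
    then have "(\<Sum>x\<in>{x. poly p x = 0}. 1) < (\<Sum>x\<in>{x. poly p x = 0}. Polynomial.order x p)"
      using x ge by (intro sum_strict_mono_ex1 fin) auto
    then show False using le by simp
  qed
  moreover have "Polynomial.order x p = 0" if "poly p x \<noteq> 0" for x
    using that by (rule order_0I)
  ultimately show ?thesis using assms(1) by (auto simp: rsquarefree_def)
qed

section \<open>The preimage tree as a regular tree\<close>

locale arboreal =
  fixes f :: "'k::field poly" and \<alpha> :: 'k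
  assumes degree_f: "Polynomial.degree f \<ge> 2"
    and card_roots: "\<And>n. n \<ge> 1 \<Longrightarrow>
      card {x :: 'k alg_closure. poly (map_poly to_ac (iterate_poly f n - [:\<alpha>:])) x = 0} = Polynomial.degree f ^ n"
    and irreducible: "\<And>n. n \<ge> 1 \<Longrightarrow> Factorial_Ring.irreducible (iterate_poly f n - [:\<alpha>:])"
begin

abbreviation F :: "'k alg_closure \<Rightarrow> 'k alg_closure" where
  "F \<equiv> poly (map_poly to_ac f)"

lemma poly_iterate_Suc:
  "poly (map_poly to_ac (iterate_poly f (Suc n))) x = poly (map_poly to_ac (iterate_poly f n)) (F x)"
  by (simp add: iterate_poly_Suc_right map_poly_to_ac_pcompose poly_pcompose)

lemma degree_shifted_iterate:
  "Polynomial.degree (map_poly to_ac (iterate_poly f n - [:\<alpha>:])) = Polynomial.degree f ^ n"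
proof -
  have "Polynomial.degree (iterate_poly f n + [:-\<alpha>:]) = Polynomial.degree (iterate_poly f n)"
    using degree_f by (intro degree_add_eq_left) (simp add: degree_iterate_poly)
  moreover have "iterate_poly f n + [:-\<alpha>:] = iterate_poly f n - [:\<alpha>:]" by simp
  ultimately show ?thesis by (simp add: degree_map_poly_to_ac degree_iterate_poly)
qed

text \<open>The shifted iterate is irreducible with distinct roots, so it witnesses the separability
  of each of its roots. Level 0, outside the hypotheses, is the linear polynomial with root
  \<alpha>.\<close>

lemma preimages_eq:
  "preimages f \<alpha> n = {x. poly (map_poly to_ac (iterate_poly f n)) x = to_ac \<alpha>}"
proof -
  let ?p = "iterate_poly f n - [:\<alpha>:]"
  have root_iff: "poly (map_poly to_ac ?p) x = 0 \<longleftrightarrow>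
    poly (map_poly to_ac (iterate_poly f n)) x = to_ac \<alpha>" for x
    by (simp add: map_poly_to_ac_diff map_poly_to_ac_pCons)
  have "card {x. poly (map_poly to_ac ?p) x = 0} = Polynomial.degree f ^ n"
    by (cases "n = 0") (simp_all add: card_roots iterate_poly_0 map_poly_to_ac_pCons)
  moreover have "Factorial_Ring.irreducible ?p"
    by (cases "n = 0") (simp_all add: irreducible iterate_poly_0 irreducible_linear_field_poly)
  moreover have "map_poly to_ac ?p \<noteq> 0"
    using degree_shifted_iterate[of n] degree_f by fastforce
  ultimately have "Factorial_Ring.irreducible ?p" "rsquarefree (map_poly to_ac ?p)"
    by (simp_all add: rsquarefreeI_card_roots degree_shifted_iterate)
  then have "x \<in> sep_closure" if "poly (map_poly to_ac ?p) x = 0" for x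
    using that unfolding sep_closure_def by blast
  then show ?thesis using root_iff by (auto simp: preimages_def)
qed

lemma preimages_0: "preimages f \<alpha> 0 = {to_ac \<alpha>}"
  by (auto simp: preimages_eq iterate_poly_0 map_poly_to_ac_pCons)

lemma preimages_Suc: "x \<in> preimages f \<alpha> (Suc n) \<longleftrightarrow> F x \<in> preimages f \<alpha> n"
  by (simp add: preimages_eq poly_iterate_Suc)

lemma card_preimages: "card (preimages f \<alpha> n) = Polynomial.degree f ^ n"
proof (cases "n = 0")
  case False
  then show ?thesis
    using card_roots[of n] by (simp add: preimages_eq map_poly_to_ac_diff map_poly_to_ac_pCons)
qed (simp add: preimages_0)

text \<open>Each fibre has at most \<open>?d\<close> points, and the \<open>?d ^ n\<close> fibres
  over level \<open>n\<close> together have \<open>?d ^ Suc n\<close>; so each has exactly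
  \<open>?d\<close>.\<close>

lemma card_fibre:
  assumes "c \<in> preimages f \<alpha> n"
  shows "card {b. F b = c} = Polynomial.degree f"
proof -
  let ?d = "Polynomial.degree f"
  have pos: "?d > 0" using degree_f by simp
  have fin: "finite (preimages f \<alpha> k)" for k
    using card_preimages[of k] pos by (metis card.infinite power_eq_0_iff less_irrefl)
  have fibre: "finite {b. F b = y} \<and> card {b. F b = y} \<le> ?d" for y
  proof -
    let ?q = "map_poly to_ac f + [:-y:]"
    have "Polynomial.degree ?q = ?d"
      using pos by (subst degree_add_eq_left) (simp_all add: degree_map_poly_to_ac)
    moreover from this have "?q \<noteq> 0" using pos by auto
    moreover have "{b. F b = y} = {b. poly ?q b = 0}" by auto
    ultimately show ?thesis using poly_roots_finite[of ?q] card_poly_roots_bound[of ?q] by metis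
  qed
  have "preimages f \<alpha> (Suc n) = (\<Union>y\<in>preimages f \<alpha> n. {b. F b = y})"
    by (auto simp: preimages_Suc)
  then have "(\<Sum>y\<in>preimages f \<alpha> n. card {b. F b = y}) = ?d ^ Suc n"
    using fibre fin card_preimages[of "Suc n"] by (subst card_UN_disjoint[symmetric]) auto
  also have "\<dots> = (\<Sum>y\<in>preimages f \<alpha> n. ?d)"
    using card_preimages[of n] by simp
  finally have eq: "(\<Sum>y\<in>preimages f \<alpha> n. card {b. F b = y}) = (\<Sum>y\<in>preimages f \<alpha> n. ?d)" .
  show ?thesis
  proof (rule ccontr)
    assume "card {b. F b = c} \<noteq> ?d"
    then have "card {b. F b = c} < ?d" using fibre[of c] by simp
    then have "(\<Sum>y\<in>preimages f \<alpha> n. card {b. F b = y}) < (\<Sum>y\<in>preimages f \<alpha> n. ?d)"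
      using fibre assms by (intro sum_strict_mono_ex1 fin) auto
    then show False using eq by simp
  qed
qed


text \<open>At level 0 the subtraction truncates; the axioms of \<open>regular_tree\<close> leave
  the parent of the root free.\<close>

definition parent :: "'k vertex \<Rightarrow> 'k vertex" where
  "parent x = (fst x - 1, F (snd x))"

lemma parent_Pair [simp]: "parent (n, x) = (n - 1, F x)"
  by (simp add: parent_def)

lemma tree_verts_iff: "(n, x) \<in> tree_verts f \<alpha> \<longleftrightarrow> x \<in> preimages f \<alpha> n"
  by (simp add: tree_verts_def)

lemma tree_root_iff: "(n, x) \<in> tree_verts f \<alpha> \<Longrightarrow> (n, x) = tree_root \<alpha> \<longleftrightarrow> n = 0"
  by (auto simp: tree_verts_iff tree_root_def preimages_0)

sublocale regular_tree "tree_verts f \<alpha>" fst parent "tree_root \<alpha>" "Polynomial.degree f"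
proof
  show "tree_root \<alpha> \<in> tree_verts f \<alpha>"
    by (simp add: tree_root_def tree_verts_iff preimages_0)
  show "fst x = 0 \<longleftrightarrow> x = tree_root \<alpha>" if "x \<in> tree_verts f \<alpha>" for x
    using that tree_root_iff by (cases x) simp
  show "parent x \<in> tree_verts f \<alpha>" "fst x = Suc (fst (parent x))"
    if x: "x \<in> tree_verts f \<alpha>" "x \<noteq> tree_root \<alpha>" for x
  proof -
    obtain n y where xy: "x = (n, y)" by (cases x)
    then have "n \<noteq> 0" using x tree_root_iff by blast
    then show "parent x \<in> tree_verts f \<alpha>" "fst x = Suc (fst (parent x))"
      using x preimages_Suc[of y "n - 1"] by (simp_all add: xy tree_verts_iff)
  qed
  show "card {x \<in> tree_verts f \<alpha>. x \<noteq> tree_root \<alpha> \<and> parent x = c} = Polynomial.degree f"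
    if "c \<in> tree_verts f \<alpha>" for c
  proof -
    obtain n y where c: "c = (n, y)" by (cases c)
    have y: "y \<in> preimages f \<alpha> n" using that by (simp add: c tree_verts_iff)
    \<comment> \<open>Every point of the fibre over \<open>y\<close> in the algebraic closure is a
      preimage of the next level, so \<open>card_fibre\<close> counts the children.\<close>
    have "{x \<in> tree_verts f \<alpha>. x \<noteq> tree_root \<alpha> \<and> parent x = c} = Pair (Suc n) ` {b. F b = y}"
    proof (intro equalityI subsetI)
      fix x assume x: "x \<in> {x \<in> tree_verts f \<alpha>. x \<noteq> tree_root \<alpha> \<and> parent x = c}"
      obtain k b where kb: "x = (k, b)" by (cases x)
      have "k \<noteq> 0" using x tree_root_iff unfolding kb by blast
      then show "x \<in> Pair (Suc n) ` {b. F b = y}" using x by (auto simp: kb c)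
    next
      fix x assume "x \<in> Pair (Suc n) ` {b. F b = y}"
      then obtain b where b: "x = (Suc n, b)" "F b = y" by blast
      then have "x \<in> tree_verts f \<alpha>" using y by (simp add: tree_verts_iff preimages_Suc)
      then show "x \<in> {x \<in> tree_verts f \<alpha>. x \<noteq> tree_root \<alpha> \<and> parent x = c}"
        using b by (simp add: c tree_root_def)
    qed
    then show ?thesis using card_fibre[OF y] by (simp add: card_image inj_on_def)
  qed
  show "Polynomial.degree f \<ge> 2" by (rule degree_f)
qed

lemma tree_edges_eq: "tree_edges f \<alpha> = edges"
proof (intro equalityI subsetI)
  fix e assume "e \<in> tree_edges f \<alpha>"
  then obtain n b where e: "e = {(Suc n, b), (n, F b)}" and b: "b \<in> preimages f \<alpha> (Suc n)"
    unfolding tree_edges_def by blast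
  have "e = {(Suc n, b), parent (Suc n, b)}" using e by simp
  moreover have "(Suc n, b) \<in> tree_verts f \<alpha>" "(Suc n, b) \<noteq> tree_root \<alpha>"
    using b by (simp_all add: tree_verts_iff tree_root_def)
  ultimately show "e \<in> edges" unfolding edges_def by blast
next
  fix e assume "e \<in> edges"
  then obtain x where x: "x \<in> tree_verts f \<alpha>" "x \<noteq> tree_root \<alpha>" "e = {x, parent x}"
    unfolding edges_def by blast
  obtain n b where nb: "x = (n, b)" by (cases x)
  then obtain k where "n = Suc k" using x tree_root_iff not0_implies_Suc by blast
  then show "e \<in> tree_edges f \<alpha>"
    using x(1,3) unfolding tree_edges_def nb by (auto simp: tree_verts_iff preimages_Suc)
qed

lemma tree_Aut_eq: "tree_Aut f \<alpha> = Aut"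
  by (simp add: tree_Aut_def Aut_def tree_edges_eq)

lemma fst_arboreal_image: "g \<in> arboreal_image f \<alpha> \<Longrightarrow> x \<in> tree_verts f \<alpha> \<Longrightarrow> fst (g x) = fst x"
  by (auto simp: arboreal_image_def arboreal_rep_def split: prod.splits)

lemma path_space_level:
  assumes "v \<in> path_space f \<alpha>"
  shows "v n \<in> tree_verts f \<alpha>" "fst (v n) = n" "parent (v (Suc n)) = v n"
proof -
  have v: "v n \<in> {n} \<times> preimages f \<alpha> n" "{v n, v (Suc n)} \<in> tree_edges f \<alpha>" for n
    using assms by (auto simp: path_space_def)
  show fst: "fst (v n) = n" for n using v(1)[of n] by auto
  show "v n \<in> tree_verts f \<alpha>" using v(1)[of n] by (auto simp: tree_verts_iff)
  obtain k b where kb: "{v n, v (Suc n)} = {(Suc k, b), (k, F b)}"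
    using v(2)[of n] unfolding tree_edges_def by blast
  have "v (Suc n) = (Suc k, b) \<and> v n = (k, F b)"
    using kb fst[of n] fst[of "Suc n"] by (auto simp: doubleton_eq_iff)
  then show "parent (v (Suc n)) = v n" by simp
qed

text \<open>Agreement with \<open>h\<close> up to level \<open>n\<close> is an open condition: it
  prescribes one coordinate in a product of discrete spaces. Every neighbourhood of a point of the
  closure meets \<open>G\<close>.\<close>

lemma closure_of_approximation:
  assumes h: "h \<in> subtopology (tree_Aut_topology f \<alpha>) H closure_of G"
  shows "h \<in> carrier Aut" "\<exists>g\<in>G. \<forall>x\<in>tree_verts f \<alpha>. fst x \<le> n \<longrightarrow> g x = h x"
proof -
  let ?r = "\<lambda>g n. restrict g (subtree_verts f \<alpha> n)"
  let ?P = "product_topology (\<lambda>n. discrete_topology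
    (rooted_auts (subtree_verts f \<alpha> n) (tree_edges f \<alpha>) (tree_root \<alpha>))) UNIV"
  have hT: "h \<in> H" "h \<in> topspace (tree_Aut_topology f \<alpha>)"
    using h closure_of_subset_topspace[of "subtopology (tree_Aut_topology f \<alpha>) H" G] by auto
  then show hA: "h \<in> carrier Aut"
    by (simp add: tree_Aut_topology_def topspace_pullback_topology tree_Aut_eq)
  have hP: "?r h \<in> topspace ?P"
    using hT by (simp add: tree_Aut_topology_def topspace_pullback_topology)
  \<comment> \<open>The cylinder set of sequences with the same \<open>n\<close>-th restriction as
    \<open>h\<close>.\<close>
  define U where "U = {\<phi> \<in> topspace ?P. \<phi> n \<in> {?r h n}}"
  have "continuous_map ?P (discrete_topology
    (rooted_auts (subtree_verts f \<alpha> n) (tree_edges f \<alpha>) (tree_root \<alpha>))) (\<lambda>\<phi>. \<phi> n)"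
    by (rule continuous_map_product_projection) simp
  moreover have "?r h n \<in> rooted_auts (subtree_verts f \<alpha> n) (tree_edges f \<alpha>) (tree_root \<alpha>)"
    using hP by (auto simp: PiE_iff)
  ultimately have "openin ?P U"
    unfolding U_def by (intro openin_continuous_map_preimage) auto
  then have "openin (tree_Aut_topology f \<alpha>) (?r -` U \<inter> carrier (tree_Aut f \<alpha>))"
    unfolding tree_Aut_topology_def openin_pullback_topology by blast
  then have op: "openin (subtopology (tree_Aut_topology f \<alpha>) H)
      (?r -` U \<inter> carrier (tree_Aut f \<alpha>) \<inter> H)"
    by (auto simp: openin_subtopology)
  have mem: "h \<in> ?r -` U \<inter> carrier (tree_Aut f \<alpha>) \<inter> H"
    using hT hA hP by (simp add: U_def tree_Aut_eq)
  obtain g where g: "g \<in> G" "g \<in> ?r -` U \<inter> carrier (tree_Aut f \<alpha>) \<inter> H"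
    using h[unfolded in_closure_of, THEN conjunct2, rule_format, OF conjI[OF mem op]] by auto
  have "g x = h x" if "x \<in> tree_verts f \<alpha>" "fst x \<le> n" for x
  proof -
    have "x \<in> subtree_verts f \<alpha> n" using that by (auto simp: subtree_verts_def tree_verts_def)
    moreover have "?r g n = ?r h n" using g(2) by (auto simp: U_def)
    ultimately show ?thesis by (metis restrict_apply')
  qed
  then show "\<exists>g\<in>G. \<forall>x\<in>tree_verts f \<alpha>. fst x \<le> n \<longrightarrow> g x = h x" using g(1) by blast
qed

end

section \<open>Application to dense subgroups of the arboreal image\<close>

theorem theorem1p8:
  fixes f :: "'k::field poly" and \<alpha> :: 'k
    and G :: "('k vertex \<Rightarrow> 'k vertex) set" and v :: "nat \<Rightarrow> 'k vertex"
  assumes deg: "Polynomial.degree f \<ge> 2"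
    and roots: "\<And>n. n \<ge> 1 \<Longrightarrow>
      card {x :: 'k alg_closure. poly (map_poly to_ac (iterate_poly f n - [:\<alpha>:])) x = 0} = Polynomial.degree f ^ n"
    and irred: "\<And>n. n \<ge> 1 \<Longrightarrow> Factorial_Ring.irreducible (iterate_poly f n - [:\<alpha>:])"
    and subgrp: "subgroup G (tree_Aut f \<alpha>)" and sub: "G \<subseteq> arboreal_image f \<alpha>"
    and cgen: "\<exists>S. countable S \<and> S \<subseteq> G \<and> G = generate (tree_Aut f \<alpha>) S"
    and dense: "subtopology (tree_Aut_topology f \<alpha>) (arboreal_image f \<alpha>) closure_of G = arboreal_image f \<alpha>"
    and fin_index: "finite (rcosets\<^bsub>tree_Aut f \<alpha>\<^esub> (arboreal_image f \<alpha>))"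
    and path: "v \<in> path_space f \<alpha>"
  shows "wild_action ((tree_Aut f \<alpha>)\<lparr>carrier := G\<rparr>) v"
proof -
  interpret arboreal f \<alpha> using deg roots irred by unfold_locales
  have closure: "h \<in> subtopology (tree_Aut_topology f \<alpha>) (arboreal_image f \<alpha>) closure_of G"
    if "h \<in> arboreal_image f \<alpha>" for h
    using that dense by simp
  have "\<not> stable_chain (Aut\<lparr>carrier := G\<rparr>) (group_chain G v)"
  proof (rule group_chain_not_stable)
    show "subgroup G Aut" using subgrp by (simp add: tree_Aut_eq)
    show "fst (g x) = fst x" if "g \<in> G" "x \<in> tree_verts f \<alpha>" for g x
      using that sub fst_arboreal_image by blast
    \<comment> \<open>By density the image equals a closure, whose points lie in the underlying
      space of the topology and hence are automorphisms.\<close>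
    show "arboreal_image f \<alpha> \<subseteq> carrier Aut"
      using closure closure_of_approximation(1) by blast
    show "G \<subseteq> arboreal_image f \<alpha>" by (rule sub)
    show "finite (rcosets\<^bsub>Aut\<^esub> (arboreal_image f \<alpha>))" using fin_index by (simp add: tree_Aut_eq)
    show "\<exists>g\<in>G. \<forall>x\<in>tree_verts f \<alpha>. fst x \<le> n \<longrightarrow> g x = h x" if "h \<in> arboreal_image f \<alpha>" for h n
      by (rule closure_of_approximation(2)[OF closure[OF that]])
    show "v n \<in> tree_verts f \<alpha>" "fst (v n) = n" "parent (v (Suc n)) = v n" for n
      using path_space_level[OF path] by blast+
  qed
  then show ?thesis by (simp add: wild_action_def stable_action_def tree_Aut_eq)
qed

end
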